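(* Let $p\in(0,1)$ and $s\in(1,\infty)$. For every $\bar u\in L^s(\Omega)$, \[ \partial^\infty q_{s,p}(\bar u)=\{\eta\in L^r(\Omega) : \{\eta\neq 0\}\subset\{\bar u=0\}\}. \]
   Context: $\Omega\subset\mathbb{R}^d$ is a Lebesgue-measurable set with positive and finite Lebesgue measure. For $s\in(1,\infty)$, $r\in(1,\infty)$ is given by $\frac1s+\frac1r=1$, and $L^r(\Omega)$ is identified with the dual of $L^s(\Omega)$. For measurable $u$, $\{u\neq0\}:=\{x\in\Omega : u(x)\neq 0\}$ and $\{u=0\}:=\{x\in\Omega : u(x)=0\}$; these sets are defined up to null sets and inclusions between them are understood up to null sets. For $p\in(0,1)$ the functional $q_{s,p}\colon L^s(\Omega)\to\mathbb{R}$ is $q_{s,p}(u):=\int_\Omega |u(x)|^p\,\mathrm{d}x$. The Fréchet subdifferential of $q_{s,p}$ at $u\in L^s(\Omega)$ is \[ \widehat{\partial} q_{s,p}(u):=\Bigl\{\eta\in L^r(\Omega) : \liminf_{\Vert h\Vert_s\searrow 0}\frac{q_{s,p}(u+h)-q_{s,p}(u)-\int_\Omega\eta(x)h(x)\,\mathrm{d}x}{\Vert h\Vert_s}\ge 0\Bigr\}, \] where the lower limit is over $h\in L^s(\Omega)\setminus\{0\}$ with $\Vert h\Vert_s\to 0$. The singular subdifferential $\partial^\infty q_{s,p}(\bar u)$ is the set of all $\eta\in L^r(\Omega)$ for which there exist sequences $\{u_k\}_{k\in\mathbb{N}}\subset L^s(\Omega)$, $\{t_k\}_{k\in\mathbb{N}}\subset(0,\infty)$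 and $\{\eta_k\}_{k\in\mathbb{N}}\subset L^r(\Omega)$ such that $u_k\to\bar u$ in $L^s(\Omega)$, $q_{s,p}(u_k)\to q_{s,p}(\bar u)$, $t_k\to 0$, $t_k\eta_k\rightharpoonup\eta$ weakly in $L^r(\Omega)$, and $\eta_k\in\widehat{\partial} q_{s,p}(u_k)$ for all $k\in\mathbb{N}$. *)

theory Defs
  imports "HOL-Analysis.Analysis"
begin

text \<open>
  Elements of \<open>L\<^sup>s\<close> are represented by measurable functions rather than by classes modulo
  almost everywhere equality. Every notion below is invariant under changing its arguments on a
  null set, so a set of representatives stands for the corresponding set of classes.
\<close>

definition Lp :: "'a measure \<Rightarrow> real \<Rightarrow> ('a \<Rightarrow> real) set" where
  "Lp M s = {u \<in> borel_measurable M. integrable M (\<lambda>x. \<bar>u x\<bar> powr s)}"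

definition Lp_norm :: "'a measure \<Rightarrow> real \<Rightarrow> ('a \<Rightarrow> real) \<Rightarrow> real" where
  "Lp_norm M s u = (\<integral>x. \<bar>u x\<bar> powr s \<partial>M) powr (1 / s)"

definition Lp_tendsto ::
  "'a measure \<Rightarrow> real \<Rightarrow> (nat \<Rightarrow> 'a \<Rightarrow> real) \<Rightarrow> ('a \<Rightarrow> real) \<Rightarrow> bool" where
  "Lp_tendsto M s v u \<longleftrightarrow> (\<lambda>k. Lp_norm M s (\<lambda>x. v k x - u x)) \<longlonglongrightarrow> 0"

text \<open>The bound makes a functional vanish on null functions, so it is well defined on classes.\<close>

definition Lp_dual :: "'a measure \<Rightarrow> real \<Rightarrow> (('a \<Rightarrow> real) \<Rightarrow> real) set" where
  "Lp_dual M s = {\<phi>.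
     (\<forall>u\<in>Lp M s. \<forall>v\<in>Lp M s. \<phi> (\<lambda>x. u x + v x) = \<phi> u + \<phi> v) \<and>
     (\<forall>c. \<forall>u\<in>Lp M s. \<phi> (\<lambda>x. c * u x) = c * \<phi> u) \<and>
     (\<exists>C. \<forall>u\<in>Lp M s. \<bar>\<phi> u\<bar> \<le> C * Lp_norm M s u)}"

definition Lp_weakly_tendsto ::
  "'a measure \<Rightarrow> real \<Rightarrow> (nat \<Rightarrow> 'a \<Rightarrow> real) \<Rightarrow> ('a \<Rightarrow> real) \<Rightarrow> bool" where
  "Lp_weakly_tendsto M s v u \<longleftrightarrow> (\<forall>\<phi>\<in>Lp_dual M s. (\<lambda>k. \<phi> (v k)) \<longlonglongrightarrow> \<phi> u)"

text \<open>Directions \<open>h \<noteq> 0\<close> in \<open>L\<^sup>s\<close> (that is, with positive norm) whose norm tends to zero.\<close>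

definition Lp_at_zero :: "'a measure \<Rightarrow> real \<Rightarrow> ('a \<Rightarrow> real) filter" where
  "Lp_at_zero M s = inf (filtercomap (Lp_norm M s) (at_right 0)) (principal (Lp M s))"

text \<open>
  In the next two definitions \<open>r\<close> is meant to be the conjugate exponent of \<open>s\<close>, and
  \<open>\<eta> \<in> L\<^sup>r\<close> acts on \<open>L\<^sup>s\<close> by integration.
\<close>

definition frechet_subdiff ::
  "'a measure \<Rightarrow> real \<Rightarrow> real \<Rightarrow> (('a \<Rightarrow> real) \<Rightarrow> real) \<Rightarrow> ('a \<Rightarrow> real) \<Rightarrow> ('a \<Rightarrow> real) set" where
  "frechet_subdiff M s r F u = {\<eta> \<in> Lp M r.
     Liminf (Lp_at_zero M s)
       (\<lambda>h. ereal ((F (\<lambda>x. u x + h x) - F u - (\<integral>x. \<eta> x * h x \<partial>M)) / Lp_norm M s h)) \<ge> 0}"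

definition singular_subdiff ::
  "'a measure \<Rightarrow> real \<Rightarrow> real \<Rightarrow> (('a \<Rightarrow> real) \<Rightarrow> real) \<Rightarrow> ('a \<Rightarrow> real) \<Rightarrow> ('a \<Rightarrow> real) set" where
  "singular_subdiff M s r F u = {\<eta> \<in> Lp M r.
     \<exists>(v :: nat \<Rightarrow> 'a \<Rightarrow> real) (t :: nat \<Rightarrow> real) (\<zeta> :: nat \<Rightarrow> 'a \<Rightarrow> real).
       (\<forall>k. v k \<in> Lp M s) \<and> (\<forall>k. t k > 0) \<and> (\<forall>k. \<zeta> k \<in> Lp M r) \<and>
       Lp_tendsto M s v u \<and> (\<lambda>k. F (v k)) \<longlonglongrightarrow> F u \<and> t \<longlonglongrightarrow> 0 \<and>
       Lp_weakly_tendsto M r (\<lambda>k x. t k * \<zeta> k x) \<eta> \<and>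
       (\<forall>k. \<zeta> k \<in> frechet_subdiff M s r F (v k))}"

definition q_functional :: "'a measure \<Rightarrow> real \<Rightarrow> ('a \<Rightarrow> real) \<Rightarrow> real" where
  "q_functional M p u = (\<integral>x. \<bar>u x\<bar> powr p \<partial>M)"

end

theory Submission
  imports Defs
begin

text \<open>
  If \<open>\<zeta>\<close> is a Frechet subgradient of \<open>q\<close> at \<open>v\<close>, then it is bounded where \<open>\<bar>v\<bar> \<ge> \<delta>\<close>, by a
  Lipschitz constant of \<open>\<bar>t\<bar> powr p\<close> away from \<open>0\<close> that does not depend on \<open>v\<close>. Hence, along a
  subsequence \<open>v\<^sub>k \<rightarrow> u\<close> converging almost everywhere, \<open>t\<^sub>k \<zeta>\<^sub>k\<close> tends uniformly to \<open>0\<close> on sets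
  where the \<open>v\<^sub>k\<close> stay away from \<open>0\<close>, and such sets exhaust \<open>{u \<noteq> 0}\<close>. Conversely, if \<open>v\<close> is
  bounded away from \<open>0\<close> on its support, the infinite slope of \<open>\<bar>t\<bar> powr p\<close> at \<open>0\<close> makes the
  values of a subgradient on \<open>{v = 0}\<close> arbitrary. So one truncates \<open>u\<close> at level \<open>t\<^sub>k\<close> and takes
  the value \<open>\<eta> / t\<^sub>k\<close> on the zero set of the truncation.
\<close>

section \<open>Elementary inequalities for real powers\<close>

text \<open>For \<open>0 \<le> x \<le> t\<close> the ratio \<open>x / t\<close> lies in
  \<open>[0, 1]\<close>, where lowering the exponent from \<open>1\<close> to \<open>p\<close>
  cannot decrease it. Taking \<open>x = |a|\<close> and \<open>x = |b|\<close> with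
  \<open>t = |a| + |b|\<close> and adding gives the claim.\<close>

lemma abs_add_powr_le:
  fixes a b p :: real
  assumes "0 < p" "p \<le> 1"
  shows "\<bar>a + b\<bar> powr p \<le> \<bar>a\<bar> powr p + \<bar>b\<bar> powr p"
proof (cases "a = 0 \<and> b = 0")
  case False
  define t where "t = \<bar>a\<bar> + \<bar>b\<bar>"
  have t: "t > 0" using False by (auto simp: t_def)
  have le: "x / t \<le> x powr p / t powr p" if "0 \<le> x" "x \<le> t" for x
    using powr_mono'[of p 1 "x / t"] that t assms by (simp add: powr_divide)
  have "1 = \<bar>a\<bar> / t + \<bar>b\<bar> / t" using t by (simp add: t_def flip: add_divide_distrib)
  also have "\<dots> \<le> \<bar>a\<bar> powr p / t powr p + \<bar>b\<bar> powr p / t powr p"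
    using t by (intro add_mono le) (auto simp: t_def)
  finally have "t powr p \<le> \<bar>a\<bar> powr p + \<bar>b\<bar> powr p"
    using t by (simp add: field_simps)
  moreover have "\<bar>a + b\<bar> powr p \<le> t powr p"
    using assms by (intro powr_mono2) (auto simp: t_def)
  ultimately show ?thesis by linarith
qed auto

text \<open>Mean value theorem on \<open>{c..}\<close>: since \<open>\<alpha> \<le> 1\<close>, the
  derivative has its largest modulus at the left end \<open>c\<close>. It serves for
  \<open>\<alpha> = p\<close> and for the exponent \<open>\<alpha> = p - 1\<close> of the
  derivative.\<close>

lemma powr_lipschitz:
  fixes a b c \<alpha> :: real
  assumes "0 < c" "c \<le> a" "c \<le> b" "\<alpha> \<le> 1"
  shows "\<bar>a powr \<alpha> - b powr \<alpha>\<bar> \<le> \<bar>\<alpha>\<bar> * c powr (\<alpha> - 1) * \<bar>a - b\<bar>"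
proof -
  have "norm (a powr \<alpha> - b powr \<alpha>) \<le> (\<bar>\<alpha>\<bar> * c powr (\<alpha> - 1)) * norm (a - b)"
  proof (rule field_differentiable_bound[where S = "{c..}"])
    show "((\<lambda>x. x powr \<alpha>) has_field_derivative \<alpha> * z powr (\<alpha> - 1)) (at z within {c..})"
      if "z \<in> {c..}" for z
      using that assms by (auto intro: has_field_derivative_at_within[OF has_real_derivative_powr])
    show "norm (\<alpha> * z powr (\<alpha> - 1)) \<le> \<bar>\<alpha>\<bar> * c powr (\<alpha> - 1)" if "z \<in> {c..}" for z
    proof -
      have "z powr (\<alpha> - 1) \<le> c powr (\<alpha> - 1)"
        using that assms by (intro powr_mono2') auto
      then show ?thesis by (simp add: abs_mult mult_left_mono)
    qed
    show "convex {c..}" "a \<in> {c..}" "b \<in> {c..}"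
      using assms by auto
  qed
  then show ?thesis by simp
qed

text \<open>Concavity obtained without calculus: the weighted arithmetic-geometric mean inequality
  for \<open>y powr p * x powr (1 - p)\<close>, multiplied by \<open>x powr (p - 1)\<close>.\<close>

lemma powr_le_tangent:
  fixes x y p :: real
  assumes "0 < x" "0 < y" "0 < p" "p < 1"
  shows "y powr p \<le> x powr p + p * x powr (p - 1) * (y - x)"
proof -
  have "y powr p * x powr (1 - p) \<le> p * y + (1 - p) * x"
    using assms by (intro Youngs_inequality_0) auto
  then have "y powr p * x powr (1 - p) * x powr (p - 1) \<le> (p * y + (1 - p) * x) * x powr (p - 1)"
    by (rule mult_right_mono) auto
  moreover have "x powr (1 - p) * x powr (p - 1) = 1"
    using assms by (simp flip: powr_add)
  moreover have "x * x powr (p - 1) = x powr p"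
    using assms by (simp add: powr_mult_base)
  moreover have "(p * y + (1 - p) * x) * x powr (p - 1) =
      p * x powr (p - 1) * y + (1 - p) * (x * x powr (p - 1))"
    "y powr p * x powr (1 - p) * x powr (p - 1) = y powr p * (x powr (1 - p) * x powr (p - 1))"
    by (simp_all add: algebra_simps)
  moreover have "x powr p + p * x powr (p - 1) * (y - x) = x powr p + p * x powr (p - 1) * y - p * (x * x powr (p - 1))"
    by (simp add: algebra_simps)
  ultimately show ?thesis by (simp add: algebra_simps)
qed

text \<open>By concavity the increment is bounded below through the slope at the displaced point,
  and that slope differs from the one at \<open>|v|\<close> by at most \<open>|h|\<close> times a
  Lipschitz constant on \<open>{c / 2..}\<close>. The constant is thus uniform over all
  \<open>v\<close> with \<open>c \<le> |v|\<close>.\<close>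

lemma abs_powr_add_ge_quadratic:
  fixes v h c p :: real
  assumes "0 < p" "p < 1" "0 < c" "c \<le> \<bar>v\<bar>" "\<bar>h\<bar> \<le> c / 2"
  shows "\<bar>v + h\<bar> powr p - \<bar>v\<bar> powr p - p * \<bar>v\<bar> powr (p - 1) * sgn v * h
    \<ge> - (p * (1 - p) * (c / 2) powr (p - 2) * \<bar>h\<bar> * \<bar>h\<bar>)"
proof -
  \<comment> \<open>Reflection to a positive base: as \<open>|h| \<le> c / 2 < |v|\<close>, adding
    \<open>h\<close> does not change the sign of \<open>v\<close>, so
    \<open>|v + h| = a + k\<close>.\<close>
  define a k where "a = \<bar>v\<bar>" and "k = sgn v * h"
  have vh: "\<bar>v + h\<bar> = a + k" and k: "\<bar>k\<bar> = \<bar>h\<bar>"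
    using assms by (auto simp: a_def k_def sgn_if abs_if split: if_splits)
  have pos: "c / 2 \<le> a" "c / 2 \<le> a + k" "0 < a" "0 < a + k"
    using assms k by (auto simp: a_def abs_if split: if_splits)
  have "a powr p \<le> (a + k) powr p + p * (a + k) powr (p - 1) * (a - (a + k))"
    using pos assms by (intro powr_le_tangent) auto
  then have 1: "(a + k) powr p - a powr p \<ge> p * (a + k) powr (p - 1) * k" by simp
  have "\<bar>(a + k) powr (p - 1) - a powr (p - 1)\<bar> \<le> \<bar>p - 1\<bar> * (c / 2) powr (p - 1 - 1) * \<bar>(a + k) - a\<bar>"
    using pos assms by (intro powr_lipschitz) auto
  then have 2: "\<bar>(a + k) powr (p - 1) - a powr (p - 1)\<bar> \<le> (1 - p) * (c / 2) powr (p - 2) * \<bar>k\<bar>"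
    using assms by (simp add: abs_if)
  have "\<bar>p * ((a + k) powr (p - 1) - a powr (p - 1)) * k\<bar>
      = p * \<bar>(a + k) powr (p - 1) - a powr (p - 1)\<bar> * \<bar>k\<bar>"
    using assms by (simp add: abs_mult)
  also have "\<dots> \<le> p * ((1 - p) * (c / 2) powr (p - 2) * \<bar>k\<bar>) * \<bar>k\<bar>"
    using assms 2 by (intro mult_right_mono mult_left_mono) auto
  finally have "p * ((a + k) powr (p - 1) - a powr (p - 1)) * k \<ge>
      - (p * (1 - p) * (c / 2) powr (p - 2) * \<bar>k\<bar> * \<bar>k\<bar>)"
    by (simp add: algebra_simps)
  also have "p * ((a + k) powr (p - 1) - a powr (p - 1)) * k =
     p * (a + k) powr (p - 1) * k - p * a powr (p - 1) * k"
    by (simp only: right_diff_distrib left_diff_distrib)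
  also have "\<dots> \<le> (a + k) powr p - a powr p - p * a powr (p - 1) * k"
    using 1 by (rule diff_right_mono)
  also have "p * a powr (p - 1) * k = p * \<bar>v\<bar> powr (p - 1) * sgn v * h"
    by (simp only: a_def k_def mult.assoc)
  finally have "- (p * (1 - p) * (c / 2) powr (p - 2) * \<bar>k\<bar> * \<bar>k\<bar>) \<le>
      (a + k) powr p - a powr p - p * \<bar>v\<bar> powr (p - 1) * sgn v * h" .
  then show ?thesis unfolding vh k by (simp only: a_def)
qed

section \<open>\<open>Lp\<close> spaces and Hoelder's inequality\<close>

lemma LpD:
  assumes "u \<in> Lp M s"
  shows "u \<in> borel_measurable M" "integrable M (\<lambda>x. \<bar>u x\<bar> powr s)"
  using assms by (auto simp: Lp_def)

lemma Lp_norm_nonneg: "0 \<le> Lp_norm M s u"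
  by (simp add: Lp_norm_def)

lemma Lp_norm_powr:
  assumes "0 < s"
  shows "Lp_norm M s u powr s = (\<integral>x. \<bar>u x\<bar> powr s \<partial>M)"
  using assms by (simp add: Lp_norm_def powr_powr)

lemma Lp_dominated:
  assumes "u \<in> Lp M s" "0 < s" "w \<in> borel_measurable M" "\<And>x. \<bar>w x\<bar> \<le> \<bar>u x\<bar>"
  shows "w \<in> Lp M s"
  using assms unfolding Lp_def
  by (auto intro!: Bochner_Integration.integrable_bound[of M "\<lambda>x. \<bar>u x\<bar> powr s"] powr_mono2 AE_I2)

lemma Lp_scale:
  assumes "u \<in> Lp M s"
  shows "(\<lambda>x. c * u x) \<in> Lp M s"
  using assms by (auto simp: Lp_def abs_mult powr_mult)

lemma Lp_add:
  assumes "u \<in> Lp M s" "v \<in> Lp M s" "0 < s"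
  shows "(\<lambda>x. u x + v x) \<in> Lp M s"
proof -
  note [measurable] = LpD(1)[OF assms(1)] LpD(1)[OF assms(2)]
  have "\<bar>u x + v x\<bar> powr s \<le> 2 powr s * (\<bar>u x\<bar> powr s + \<bar>v x\<bar> powr s)" for x
  proof -
    have "\<bar>u x + v x\<bar> powr s \<le> (2 * max \<bar>u x\<bar> \<bar>v x\<bar>) powr s"
      using assms(3) by (intro powr_mono2) auto
    also have "\<dots> = 2 powr s * max \<bar>u x\<bar> \<bar>v x\<bar> powr s" by (simp add: powr_mult)
    also have "\<dots> \<le> 2 powr s * (\<bar>u x\<bar> powr s + \<bar>v x\<bar> powr s)"
      by (intro mult_left_mono) (auto simp: max_def)
    finally show ?thesis .
  qed
  moreover have "integrable M (\<lambda>x. 2 powr s * (\<bar>u x\<bar> powr s + \<bar>v x\<bar> powr s))"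
    using assms LpD by (intro integrable_mult_right Bochner_Integration.integrable_add) auto
  ultimately have "integrable M (\<lambda>x. \<bar>u x + v x\<bar> powr s)"
    by (elim Bochner_Integration.integrable_bound) (auto intro!: AE_I2)
  then show ?thesis by (simp add: Lp_def)
qed

lemma (in finite_measure) Lp_bounded:
  assumes "w \<in> borel_measurable M" "0 < s" "\<And>x. \<bar>w x\<bar> \<le> (C::real)"
  shows "w \<in> Lp M s"
  using assms unfolding Lp_def
  by (auto intro!: integrable_const_bound[of _ "C powr s"] powr_mono2 AE_I2)

text \<open>Pointwise \<open>a powr p \<le> 1 + a powr s\<close>, and constants are integrable over
  a finite measure. For \<open>p < 1\<close> this makes \<open>q_functional\<close> a genuine
  integral on \<open>Lp M s\<close>, not the default value \<open>0\<close> of a non-integrable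
  function.\<close>

lemma (in finite_measure) Lp_mono:
  assumes "u \<in> Lp M s" "0 < p" "p \<le> s"
  shows "u \<in> Lp M p"
proof -
  note [measurable] = LpD(1)[OF assms(1)]
  have le: "a powr p \<le> 1 + a powr s" if "0 \<le> a" for a :: real
  proof (cases "a \<le> 1")
    case True
    then have "a powr p \<le> 1 powr p" using that assms by (intro powr_mono2) auto
    then show ?thesis by (simp add: add_increasing2)
  next
    case False
    then have "a powr p \<le> a powr s" using assms by (intro powr_mono) auto
    then show ?thesis by linarith
  qed
  have "integrable M (\<lambda>x. 1 + \<bar>u x\<bar> powr s)"
    using LpD(2)[OF assms(1)] by simp
  then have "integrable M (\<lambda>x. \<bar>u x\<bar> powr p)"
  proof (rule Bochner_Integration.integrable_bound)
    have "norm (\<bar>u x\<bar> powr p) \<le> norm (1 + \<bar>u x\<bar> powr s)" for x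
      using le[of "\<bar>u x\<bar>"] by simp
    then show "AE x in M. norm (\<bar>u x\<bar> powr p) \<le> norm (1 + \<bar>u x\<bar> powr s)"
      by (rule AE_I2)
  qed measurable
  then show ?thesis by (simp add: Lp_def)
qed

text \<open>Young's inequality for \<open>f / F\<close> and \<open>g / G\<close>, whose right-hand
  side integrates to \<open>1 / r + 1 / s = 1\<close>. A vanishing norm forbids the division but
  makes the product zero almost everywhere.\<close>

lemma Holder_inequality:
  assumes "1 < s" "1 < r" "1 / s + 1 / r = 1" "f \<in> Lp M r" "g \<in> Lp M s"
  shows "integrable M (\<lambda>x. f x * g x)"
    and "(\<integral>x. \<bar>f x * g x\<bar> \<partial>M) \<le> Lp_norm M r f * Lp_norm M s g"
proof -
  note [measurable] = LpD(1)[OF assms(4)] LpD(1)[OF assms(5)]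
  note int = LpD(2)[OF assms(4)] LpD(2)[OF assms(5)]
  have Y: "\<bar>a * b\<bar> \<le> \<bar>a\<bar> powr r / r + \<bar>b\<bar> powr s / s" for a b :: real
    using Youngs_inequality[of r s "\<bar>a\<bar>" "\<bar>b\<bar>"] assms by (simp add: abs_mult add.commute)
  show I: "integrable M (\<lambda>x. f x * g x)"
    by (rule Bochner_Integration.integrable_bound[of M "\<lambda>x. \<bar>f x\<bar> powr r / r + \<bar>g x\<bar> powr s / s"])
      (use Y int assms in \<open>auto intro: order_trans\<close>)
  define F G where "F = Lp_norm M r f" and "G = Lp_norm M s g"
  show "(\<integral>x. \<bar>f x * g x\<bar> \<partial>M) \<le> Lp_norm M r f * Lp_norm M s g"
  proof (cases "F = 0 \<or> G = 0")
    case True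
    then have "AE x in M. f x * g x = 0"
    proof
      assume "F = 0"
      then have "(\<integral>x. \<bar>f x\<bar> powr r \<partial>M) = 0" by (simp add: F_def Lp_norm_def)
      then have "AE x in M. \<bar>f x\<bar> powr r = 0"
        using int by (subst (asm) integral_nonneg_eq_0_iff_AE) auto
      then show ?thesis by eventually_elim auto
    next
      assume "G = 0"
      then have "(\<integral>x. \<bar>g x\<bar> powr s \<partial>M) = 0" by (simp add: G_def Lp_norm_def)
      then have "AE x in M. \<bar>g x\<bar> powr s = 0"
        using int by (subst (asm) integral_nonneg_eq_0_iff_AE) auto
      then show ?thesis by eventually_elim auto
    qed
    then have "(\<integral>x. \<bar>f x * g x\<bar> \<partial>M) = (\<integral>x. 0 \<partial>M)"
      by (intro integral_cong_AE) auto
    then show ?thesis by (simp add: Lp_norm_nonneg)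
  next
    case False
    then have pos: "F > 0" "G > 0"
      using Lp_norm_nonneg[of M r f] Lp_norm_nonneg[of M s g] by (auto simp: F_def G_def)
    have "(\<integral>x. \<bar>f x * g x\<bar> \<partial>M) / (F * G) = (\<integral>x. \<bar>(f x / F) * (g x / G)\<bar> \<partial>M)"
      using pos by (simp add: abs_mult)
    also have "\<dots> \<le> (\<integral>x. \<bar>f x\<bar> powr r / (F powr r * r) + \<bar>g x\<bar> powr s / (G powr s * s) \<partial>M)"
    proof (rule integral_mono)
      show "\<bar>(f x / F) * (g x / G)\<bar> \<le> \<bar>f x\<bar> powr r / (F powr r * r) + \<bar>g x\<bar> powr s / (G powr s * s)" for x
        using Y[of "f x / F" "g x / G"] pos by (simp add: powr_divide)
      have "integrable M (\<lambda>x. \<bar>f x * g x\<bar> / (F * G))" using I by auto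
      then show "integrable M (\<lambda>x. \<bar>(f x / F) * (g x / G)\<bar>)" using pos by (simp add: abs_mult)
    qed (use int in auto)
    also have "\<dots> = (\<integral>x. \<bar>f x\<bar> powr r \<partial>M) / (F powr r * r) + (\<integral>x. \<bar>g x\<bar> powr s \<partial>M) / (G powr s * s)"
      using int by simp
    also have "\<dots> = F powr r / (F powr r * r) + G powr s / (G powr s * s)"
      using assms by (simp add: F_def G_def Lp_norm_powr)
    also have "\<dots> = 1"
      using assms pos by (simp add: add.commute)
    finally show ?thesis using pos by (simp add: F_def G_def field_simps)
  qed
qed

section \<open>Frechet subgradients of \<open>q_functional\<close>\<close>

text \<open>Trades the lower limit along \<open>Lp_at_zero\<close> for an epsilon-rho condition free
  of quotients, the form in which subgradients are later produced and tested.\<close>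

lemma frechet_subdiff_iff:
  "\<eta> \<in> frechet_subdiff M s r F u \<longleftrightarrow> \<eta> \<in> Lp M r \<and>
    (\<forall>\<epsilon>>0. \<exists>\<rho>>0. \<forall>h\<in>Lp M s. 0 < Lp_norm M s h \<longrightarrow> Lp_norm M s h < \<rho> \<longrightarrow>
      F (\<lambda>x. u x + h x) - F u - (\<integral>x. \<eta> x * h x \<partial>M) \<ge> - \<epsilon> * Lp_norm M s h)"
proof -
  define Q where "Q h = F (\<lambda>x. u x + h x) - F u - (\<integral>x. \<eta> x * h x \<partial>M)" for h
  define N where "N = Lp_norm M s"
  have ev: "(\<forall>\<^sub>F h in Lp_at_zero M s. P h) \<longleftrightarrow>
      (\<exists>\<rho>>0. \<forall>h\<in>Lp M s. 0 < N h \<longrightarrow> N h < \<rho> \<longrightarrow> P h)" (is "?L \<longleftrightarrow> ?R") for P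
  proof -
    have "?L \<longleftrightarrow> (\<exists>S. (\<exists>\<rho>>0. \<forall>y>0. y < \<rho> \<longrightarrow> S y) \<and> (\<forall>h. S (N h) \<longrightarrow> h \<in> Lp M s \<longrightarrow> P h))"
      by (simp add: Lp_at_zero_def eventually_inf_principal eventually_filtercomap
          eventually_at_right_field N_def)
    also have "\<dots> \<longleftrightarrow> ?R"
    proof
      assume ?R
      then obtain \<rho> where "\<rho> > 0" "\<forall>h\<in>Lp M s. 0 < N h \<longrightarrow> N h < \<rho> \<longrightarrow> P h" by blast
      then show "\<exists>S. (\<exists>\<rho>>0. \<forall>y>0. y < \<rho> \<longrightarrow> S y) \<and> (\<forall>h. S (N h) \<longrightarrow> h \<in> Lp M s \<longrightarrow> P h)"
        by (intro exI[of _ "\<lambda>y. 0 < y \<and> y < \<rho>"]) auto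
    qed blast
    finally show ?thesis .
  qed
  have "0 \<le> Liminf (Lp_at_zero M s) (\<lambda>h. ereal (Q h / N h)) \<longleftrightarrow>
      (\<forall>\<epsilon>>0. \<forall>\<^sub>F h in Lp_at_zero M s. - \<epsilon> < Q h / N h)"
  proof (subst le_Liminf_iff, intro iffI allI impI)
    fix \<epsilon> :: real assume "\<forall>y<0. \<forall>\<^sub>F h in Lp_at_zero M s. y < ereal (Q h / N h)" "0 < \<epsilon>"
    then show "\<forall>\<^sub>F h in Lp_at_zero M s. - \<epsilon> < Q h / N h"
      by (auto dest: spec[of _ "ereal (- \<epsilon>)"])
  next
    fix y :: ereal assume *: "\<forall>\<epsilon>>0. \<forall>\<^sub>F h in Lp_at_zero M s. - \<epsilon> < Q h / N h" "y < 0"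
    \<comment> \<open>A finite \<open>y < 0\<close> gives \<open>\<delta> = - y\<close>; for
      \<open>y = -\<infinity>\<close> the value \<open>1\<close> serves.\<close>
    then obtain \<delta> where "y \<le> ereal (- \<delta>)" "0 < \<delta>"
      by (cases y) (auto intro: that[of "- real_of_ereal y"] that[of 1])
    with * have "\<forall>\<^sub>F h in Lp_at_zero M s. - \<delta> < Q h / N h" by auto
    then show "\<forall>\<^sub>F h in Lp_at_zero M s. y < ereal (Q h / N h)"
      by eventually_elim (use \<open>y \<le> _\<close> in \<open>auto intro: le_less_trans\<close>)
  qed
  also have "\<dots> \<longleftrightarrow> (\<forall>\<epsilon>>0. \<exists>\<rho>>0. \<forall>h\<in>Lp M s. 0 < N h \<longrightarrow> N h < \<rho> \<longrightarrow> Q h \<ge> - \<epsilon> * N h)"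
    (is "?A \<longleftrightarrow> ?B")
  proof
    assume A: ?A
    show ?B
    proof (intro allI impI)
      fix \<epsilon> :: real assume "\<epsilon> > 0"
      with A have "\<exists>\<rho>>0. \<forall>h\<in>Lp M s. 0 < N h \<longrightarrow> N h < \<rho> \<longrightarrow> - \<epsilon> < Q h / N h" by (simp add: ev)
      then obtain \<rho> where "\<rho> > 0" "\<forall>h\<in>Lp M s. 0 < N h \<longrightarrow> N h < \<rho> \<longrightarrow> - \<epsilon> < Q h / N h" by blast
      then show "\<exists>\<rho>>0. \<forall>h\<in>Lp M s. 0 < N h \<longrightarrow> N h < \<rho> \<longrightarrow> Q h \<ge> - \<epsilon> * N h"
        by (intro exI[of _ \<rho>]) (auto simp: field_simps dest!: bspec)
    qed
  next
    assume B: ?B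
    show ?A
    proof (intro allI impI)
      fix \<epsilon> :: real assume "\<epsilon> > 0"
      \<comment> \<open>Half of \<open>\<epsilon>\<close> leaves room to turn the nonstrict bound
        into a strict one.\<close>
      then have "\<exists>\<rho>>0. \<forall>h\<in>Lp M s. 0 < N h \<longrightarrow> N h < \<rho> \<longrightarrow> Q h \<ge> - (\<epsilon> / 2) * N h"
        by (rule B[rule_format, OF half_gt_zero])
      then obtain \<rho> where \<rho>: "\<rho> > 0"
        "\<And>h. h\<in>Lp M s \<Longrightarrow> 0 < N h \<Longrightarrow> N h < \<rho> \<Longrightarrow> Q h \<ge> - (\<epsilon> / 2) * N h" by blast
      have "- \<epsilon> < Q h / N h" if "h\<in>Lp M s" "0 < N h" "N h < \<rho>" for h
      proof -
        have "- \<epsilon> * N h < - (\<epsilon> / 2) * N h" using \<open>\<epsilon> > 0\<close> that by simp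
        also have "\<dots> \<le> Q h" using \<rho> that by auto
        finally show ?thesis using that by (simp add: pos_less_divide_eq)
      qed
      then show "\<forall>\<^sub>F h in Lp_at_zero M s. - \<epsilon> < Q h / N h" using \<open>\<rho> > 0\<close> unfolding ev by blast
    qed
  qed
  finally show ?thesis by (simp add: frechet_subdiff_def Q_def N_def)
qed

text \<open>
  The error is split so that Hoelder's inequality makes each part small relative to \<open>\<parallel>h\<parallel>\<^sub>s\<close>:
  small \<open>h\<close> costs \<open>e \<bar>h\<bar>\<close>, large \<open>h\<close> is absorbed by \<open>\<bar>h\<bar>\<^sup>s\<close> since \<open>s > 1\<close>, and the tail of \<open>z\<close>
  beyond \<open>K\<close> is small in \<open>L\<^sup>r\<close>.
\<close>

lemma abs_powr_add_lower_bound: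
  fixes v h c p s e \<tau> K z :: real
  assumes p: "0 < p" "p < 1" and s: "1 < s" and c: "0 < c" "v \<noteq> 0 \<Longrightarrow> c \<le> \<bar>v\<bar>"
    and z: "v \<noteq> 0 \<Longrightarrow> z = p * \<bar>v\<bar> powr (p - 1) * sgn v"
    and \<tau>: "0 < \<tau>" "\<tau> \<le> c / 2" "K * \<tau> powr (1 - p) \<le> 1" "p * (1 - p) * (c / 2) powr (p - 2) * \<tau> \<le> e"
    and K: "0 \<le> K" and e: "0 \<le> e"
  shows "- (e * \<bar>h\<bar> + (\<tau> powr (p - 1) + K) * \<tau> powr (1 - s) * \<bar>h\<bar> powr s
      + (if \<bar>z\<bar> > K then \<bar>z\<bar> else 0) * \<bar>h\<bar>)
    \<le> \<bar>v + h\<bar> powr p - \<bar>v\<bar> powr p - z * h"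
proof -
  define T where "T = (if \<bar>z\<bar> > K then \<bar>z\<bar> else 0)"
  define S where "S = (\<tau> powr (p - 1) + K) * \<tau> powr (1 - s) * \<bar>h\<bar> powr s"
  define D where "D = \<bar>v + h\<bar> powr p - \<bar>v\<bar> powr p - z * h"
  have T: "0 \<le> T * \<bar>h\<bar>" and S: "0 \<le> S" and eh: "0 \<le> e * \<bar>h\<bar>"
    using K e by (auto simp: T_def S_def)
  have "- (e * \<bar>h\<bar> + S + T * \<bar>h\<bar>) \<le> D"
  proof (cases "\<bar>h\<bar> \<le> \<tau>")
    case True
    show ?thesis
    proof (cases "v = 0")
      case v: False
      have "- (p * (1 - p) * (c / 2) powr (p - 2) * \<bar>h\<bar> * \<bar>h\<bar>) \<le> D"
        using abs_powr_add_ge_quadratic[OF p c(1) c(2)[OF v], of h] True \<tau> z[OF v]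
        by (simp add: D_def)
      moreover have "p * (1 - p) * (c / 2) powr (p - 2) * \<bar>h\<bar> \<le> e"
        using True p by (intro order_trans[OF mult_left_mono \<tau>(4)]) auto
      then have "p * (1 - p) * (c / 2) powr (p - 2) * \<bar>h\<bar> * \<bar>h\<bar> \<le> e * \<bar>h\<bar>"
        by (rule mult_right_mono) auto
      ultimately show ?thesis using T S by linarith
    next
      case v: True
      have zh: "- (\<bar>z\<bar> * \<bar>h\<bar>) \<le> - (z * h)" by (metis abs_ge_self abs_mult neg_le_iff_le)
      show ?thesis
      proof (cases "\<bar>z\<bar> > K")
        case True
        \<comment> \<open>The nonnegative \<open>|h| powr p\<close> is dropped and the linear term
          charged in full to the tail of \<open>z\<close>.\<close>
        have "- (\<bar>z\<bar> * \<bar>h\<bar>) \<le> \<bar>h\<bar> powr p - z * h"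
          using zh powr_ge_zero[of "\<bar>h\<bar>" p] by linarith
        then have "- (T * \<bar>h\<bar>) \<le> D" using v True by (simp add: D_def T_def)
        then show ?thesis using S eh by linarith
      next
        case False
        \<comment> \<open>The infinite slope at \<open>0\<close> enters here: \<open>K * |h|\<close>
          is at most \<open>|h| powr p\<close>, because
          \<open>K * |h| powr (1 - p) \<le> K * \<tau> powr (1 - p) \<le> 1\<close>.\<close>
        have "\<bar>z\<bar> * \<bar>h\<bar> \<le> K * \<bar>h\<bar>" using False by (intro mult_right_mono) auto
        also have "\<dots> = K * \<bar>h\<bar> powr (1 - p) * \<bar>h\<bar> powr p"
          by (cases "h = 0") (auto simp flip: powr_add)
        also have "\<dots> \<le> K * \<tau> powr (1 - p) * \<bar>h\<bar> powr p"
          using True K p by (intro mult_right_mono mult_left_mono powr_mono2) auto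
        also have "\<dots> \<le> 1 * \<bar>h\<bar> powr p" using \<tau> by (intro mult_right_mono) auto
        finally have "0 \<le> D" using zh p v by (simp add: D_def)
        then show ?thesis using T S eh by linarith
      qed
    qed
  next
    case False
    then have h: "0 < \<bar>h\<bar>" "\<tau> \<le> \<bar>h\<bar>" using \<tau> by auto
    \<comment> \<open>Splitting \<open>v\<close> as \<open>(v + h) + (- h)\<close> shows a loss of
      at most \<open>|h| powr p\<close>. Since \<open>\<tau> < |h|\<close>, this loss and the part
      of \<open>z * h\<close> up to the cut-off \<open>K\<close> are bounded by multiples of
      \<open>|h|\<close>, which in turn fit under \<open>|h| powr s\<close>.\<close>
    have 1: "\<bar>v\<bar> powr p \<le> \<bar>v + h\<bar> powr p + \<bar>h\<bar> powr p"
      using abs_add_powr_le[of p "v + h" "-h"] p by simp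
    have "\<bar>h\<bar> powr p = \<bar>h\<bar> powr (p - 1) * \<bar>h\<bar>" using h powr_mult_base[of "\<bar>h\<bar>" "p - 1"] by (simp add: mult.commute)
    also have "\<dots> \<le> \<tau> powr (p - 1) * \<bar>h\<bar>"
      using h \<tau> p by (intro mult_right_mono powr_mono2') auto
    finally have 2: "\<bar>h\<bar> powr p \<le> \<tau> powr (p - 1) * \<bar>h\<bar>" .
    have "\<bar>h\<bar> = \<bar>h\<bar> powr (1 - s) * \<bar>h\<bar> powr s" using h by (simp flip: powr_add)
    also have "\<dots> \<le> \<tau> powr (1 - s) * \<bar>h\<bar> powr s"
      using h \<tau> s by (intro mult_right_mono powr_mono2') auto
    finally have "(\<tau> powr (p - 1) + K) * \<bar>h\<bar> \<le> (\<tau> powr (p - 1) + K) * (\<tau> powr (1 - s) * \<bar>h\<bar> powr s)"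
      using K by (intro mult_left_mono) auto
    then have 3: "\<tau> powr (p - 1) * \<bar>h\<bar> + K * \<bar>h\<bar> \<le> S" by (simp add: S_def algebra_simps)
    have "z * h \<le> \<bar>z\<bar> * \<bar>h\<bar>" by (metis abs_ge_self abs_mult)
    also have "\<dots> \<le> (K + T) * \<bar>h\<bar>" using K by (intro mult_right_mono) (auto simp: T_def)
    finally have "z * h \<le> K * \<bar>h\<bar> + T * \<bar>h\<bar>" by (simp add: algebra_simps)
    then have "- (S + T * \<bar>h\<bar>) \<le> D" using 1 2 3 unfolding D_def by linarith
    then show ?thesis using eh by linarith
  qed
  then show ?thesis by (simp add: D_def S_def T_def)
qed

text \<open>Dominated convergence with majorant \<open>|f| powr r\<close>: at each point the
  truncated integrand is zero as soon as \<open>n\<close> reaches \<open>|f x|\<close>.\<close>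

lemma Lp_norm_tail_tendsto_0:
  assumes "f \<in> Lp M r" "0 < r"
  shows "(\<lambda>n. Lp_norm M r (\<lambda>x. if \<bar>f x\<bar> > real n then \<bar>f x\<bar> else 0)) \<longlonglongrightarrow> 0"
proof -
  note [measurable] = LpD(1)[OF assms(1)]
  have "(\<lambda>n. \<integral>x. \<bar>if \<bar>f x\<bar> > real n then \<bar>f x\<bar> else 0\<bar> powr r \<partial>M) \<longlonglongrightarrow> (\<integral>x. 0 \<partial>M)"
  proof (rule integral_dominated_convergence[where w = "\<lambda>x. \<bar>f x\<bar> powr r"])
    show "AE x in M. (\<lambda>n. \<bar>if \<bar>f x\<bar> > real n then \<bar>f x\<bar> else 0\<bar> powr r) \<longlonglongrightarrow> 0"
    proof (rule AE_I2)
      fix x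
      obtain N where N: "\<bar>f x\<bar> \<le> real N" using real_arch_simple by blast
      have "\<forall>\<^sub>F n in sequentially. \<bar>if \<bar>f x\<bar> > real n then \<bar>f x\<bar> else 0\<bar> powr r = 0"
        using eventually_ge_at_top[of N]
      proof eventually_elim
        case (elim n)
        then have "real N \<le> real n" by simp
        then show ?case using N by simp
      qed
      then show "(\<lambda>n. \<bar>if \<bar>f x\<bar> > real n then \<bar>f x\<bar> else 0\<bar> powr r) \<longlonglongrightarrow> 0"
        by (rule tendsto_eventually)
    qed
  qed (use LpD(2)[OF assms(1)] in \<open>auto intro!: AE_I2\<close>)
  then have "(\<lambda>n. Lp_norm M r (\<lambda>x. if \<bar>f x\<bar> > real n then \<bar>f x\<bar> else 0)) \<longlonglongrightarrow> 0 powr (1 / r)"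
    unfolding Lp_norm_def
    by (intro tendsto_powr2) (use assms in auto)
  then show ?thesis by simp
qed

text \<open>On the support of \<open>v\<close> the value of \<open>\<zeta>\<close> is the derivative
  of \<open>|t| powr p\<close>; off the support it is free. Integrating
  \<open>abs_powr_add_lower_bound\<close> leaves three error terms, each made at most
  \<open>\<epsilon> / 3\<close> times the norm of \<open>h\<close>.\<close>

lemma (in finite_measure) frechet_subdiff_q_functionalI:
  assumes p: "0 < p" "p < 1" and sr: "1 < s" "1 < r" "1 / s + 1 / r = 1"
    and v: "v \<in> Lp M s" and \<zeta>: "\<zeta> \<in> Lp M r"
    and c: "0 < c" "\<And>x. v x \<noteq> 0 \<Longrightarrow> c \<le> \<bar>v x\<bar>"
    and \<zeta>_eq: "\<And>x. v x \<noteq> 0 \<Longrightarrow> \<zeta> x = p * \<bar>v x\<bar> powr (p - 1) * sgn (v x)"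
  shows "\<zeta> \<in> frechet_subdiff M s r (q_functional M p) v"
  unfolding frechet_subdiff_iff
proof (intro conjI \<zeta> allI impI)
  fix \<epsilon> :: real assume \<epsilon>: "0 < \<epsilon>"
  note [measurable] = LpD(1)[OF \<zeta>] LpD(1)[OF v]
  define N where "N = Lp_norm M r (\<lambda>_. 1)"
  \<comment> \<open>Hoelder against the constant \<open>1\<close> costs a factor \<open>N\<close>;
    the summand \<open>1\<close> keeps the denominator positive when \<open>N = 0\<close>.\<close>
  define e where "e = \<epsilon> / (3 * (N + 1))"
  have N: "0 \<le> N" by (simp add: N_def Lp_norm_nonneg)
  have e: "0 < e" "e * N \<le> \<epsilon> / 3" using N \<epsilon> by (auto simp: e_def field_simps)
  \<comment> \<open>\<open>real n\<close> becomes the cut-off \<open>K\<close>, and Hoelder bounds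
    the tail term by this norm.\<close>
  have "\<forall>\<^sub>F n in sequentially. Lp_norm M r (\<lambda>x. if \<bar>\<zeta> x\<bar> > real n then \<bar>\<zeta> x\<bar> else 0) < \<epsilon> / 3"
    using Lp_norm_tail_tendsto_0[OF \<zeta>] \<epsilon> sr by (intro order_tendstoD) auto
  then obtain n where n: "Lp_norm M r (\<lambda>x. if \<bar>\<zeta> x\<bar> > real n then \<bar>\<zeta> x\<bar> else 0) < \<epsilon> / 3"
    using eventually_happens'[OF sequentially_bot] by blast
  define T where "T x = (if \<bar>\<zeta> x\<bar> > real n then \<bar>\<zeta> x\<bar> else 0)" for x
  have T: "T \<in> Lp M r"
    using sr by (intro Lp_dominated[OF \<zeta>]) (auto simp: T_def[abs_def])
  \<comment> \<open>Each constraint on \<open>\<tau>\<close> holds for all small positive values, so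
    the filter \<open>at_right 0\<close> supplies a common one.\<close>
  have "\<forall>\<^sub>F \<tau> in at_right 0. 0 < \<tau> \<and> \<tau> \<le> c / 2 \<and> real n * \<tau> powr (1 - p) \<le> 1 \<and>
      p * (1 - p) * (c / 2) powr (p - 2) * \<tau> \<le> e"
  proof (intro eventually_conj)
    show "\<forall>\<^sub>F \<tau> in at_right 0. 0 < (\<tau>::real)" by (simp add: eventually_at_right_less)
    have "((\<lambda>\<tau>::real. \<tau>) \<longlongrightarrow> 0) (at_right 0)" by (rule tendsto_ident_at)
    then have "\<forall>\<^sub>F \<tau> in at_right 0. \<tau> < c / 2" using c by (intro order_tendstoD) auto
    then show "\<forall>\<^sub>F \<tau> in at_right 0. \<tau> \<le> c / 2" by eventually_elim auto
    have "((\<lambda>\<tau>. real n * \<tau> powr (1 - p)) \<longlongrightarrow> real n * 0 powr (1 - p)) (at_right 0)"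
    proof (intro tendsto_mult_left tendsto_powr2 tendsto_ident_at tendsto_const)
      show "\<forall>\<^sub>F x in at_right 0. 0 \<le> (x::real)"
        by (rule eventually_mono[OF eventually_at_right_less]) auto
    qed (use p in simp)
    then have "\<forall>\<^sub>F \<tau> in at_right 0. real n * \<tau> powr (1 - p) < 1"
      by (intro order_tendstoD) auto
    then show "\<forall>\<^sub>F \<tau> in at_right 0. real n * \<tau> powr (1 - p) \<le> 1" by eventually_elim auto
    have "((\<lambda>\<tau>. p * (1 - p) * (c / 2) powr (p - 2) * \<tau>) \<longlongrightarrow> p * (1 - p) * (c / 2) powr (p - 2) * 0) (at_right 0)"
      by (intro tendsto_intros)
    then have "\<forall>\<^sub>F \<tau> in at_right 0. p * (1 - p) * (c / 2) powr (p - 2) * \<tau> < e"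
      using e by (intro order_tendstoD) auto
    then show "\<forall>\<^sub>F \<tau> in at_right 0. p * (1 - p) * (c / 2) powr (p - 2) * \<tau> \<le> e" by eventually_elim auto
  qed
  then obtain \<tau> where \<tau>: "0 < \<tau>" "\<tau> \<le> c / 2" "real n * \<tau> powr (1 - p) \<le> 1"
    "p * (1 - p) * (c / 2) powr (p - 2) * \<tau> \<le> e"
    using eventually_happens'[OF trivial_limit_at_right_real] by blast
  define A where "A = (\<tau> powr (p - 1) + real n) * \<tau> powr (1 - s)"
  \<comment> \<open>Solves \<open>A * \<rho> powr (s - 1) = \<epsilon> / 3\<close>: with
    \<open>L\<close> the norm of \<open>h\<close>, the integral of \<open>|h| powr s\<close> is
    \<open>L powr (s - 1) * L\<close>.\<close>
  define \<rho> where "\<rho> = (\<epsilon> / (3 * A)) powr (1 / (s - 1))"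
  have A: "0 < A" using \<tau> by (simp add: A_def add_pos_nonneg)
  have \<rho>: "0 < \<rho>" "\<rho> powr (s - 1) = \<epsilon> / (3 * A)" using A \<epsilon> sr by (auto simp: \<rho>_def powr_powr)
  show "\<exists>\<rho>>0. \<forall>h\<in>Lp M s. 0 < Lp_norm M s h \<longrightarrow> Lp_norm M s h < \<rho> \<longrightarrow>
      q_functional M p (\<lambda>x. v x + h x) - q_functional M p v - (\<integral>x. \<zeta> x * h x \<partial>M) \<ge> - \<epsilon> * Lp_norm M s h"
  proof (intro exI[of _ \<rho>] conjI ballI impI \<rho>(1))
    fix h assume h: "h \<in> Lp M s" "0 < Lp_norm M s h" "Lp_norm M s h < \<rho>"
    note [measurable] = LpD(1)[OF h(1)]
    define L where "L = Lp_norm M s h"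
    have one: "(\<lambda>_. 1) \<in> Lp M r" using sr by (intro Lp_bounded[where C = 1]) auto
    have "(\<integral>x. \<bar>1 * h x\<bar> \<partial>M) \<le> N * L"
      unfolding N_def L_def by (rule Holder_inequality(2)[OF sr one h(1)])
    then have 1: "(\<integral>x. \<bar>h x\<bar> \<partial>M) \<le> N * L" by simp
    have i1: "integrable M (\<lambda>x. \<bar>h x\<bar>)"
      using Holder_inequality(1)[OF sr one h(1)] by simp
    have iT: "integrable M (\<lambda>x. T x * \<bar>h x\<bar>)"
      using integrable_abs[OF Holder_inequality(1)[OF sr T h(1)]] by (simp add: abs_mult T_def)
    have "(\<integral>x. \<bar>T x * h x\<bar> \<partial>M) \<le> Lp_norm M r T * L"
      unfolding L_def by (rule Holder_inequality(2)[OF sr T h(1)])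
    also have "\<dots> \<le> \<epsilon> / 3 * L"
      using n h by (intro mult_right_mono) (auto simp: T_def[abs_def] L_def)
    finally have 2: "(\<integral>x. T x * \<bar>h x\<bar> \<partial>M) \<le> \<epsilon> / 3 * L" by (simp add: abs_mult T_def)
    have "A * (\<integral>x. \<bar>h x\<bar> powr s \<partial>M) = A * (L powr (s - 1) * L)"
      using Lp_norm_powr[of s M h] powr_mult_base[of L "s - 1"] sr h
      by (simp add: L_def mult.commute)
    also have "\<dots> \<le> A * (\<rho> powr (s - 1) * L)"
      using A h sr by (intro mult_left_mono mult_right_mono powr_mono2) (auto simp: L_def)
    also have "\<dots> = \<epsilon> / 3 * L" using A \<rho> by simp
    finally have 3: "A * (\<integral>x. \<bar>h x\<bar> powr s \<partial>M) \<le> \<epsilon> / 3 * L" .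
    have "e * (\<integral>x. \<bar>h x\<bar> \<partial>M) \<le> e * (N * L)" using 1 e by (intro mult_left_mono) auto
    also have "\<dots> = e * N * L" by simp
    also have "\<dots> \<le> \<epsilon> / 3 * L" using e h by (intro mult_right_mono) (auto simp: L_def)
    finally have 4: "e * (\<integral>x. \<bar>h x\<bar> \<partial>M) \<le> \<epsilon> / 3 * L" .
    have ih: "integrable M (\<lambda>x. \<bar>h x\<bar> powr s)" using LpD(2)[OF h(1)] .
    have vh: "(\<lambda>x. v x + h x) \<in> Lp M p" "v \<in> Lp M p"
      using p sr v h by (auto intro!: Lp_mono[of _ s] Lp_add)
    note iq = LpD(2)[OF vh(1)] LpD(2)[OF vh(2)] Holder_inequality(1)[OF sr \<zeta> h(1)]
    have "- \<epsilon> * L \<le> - (e * (\<integral>x. \<bar>h x\<bar> \<partial>M) + A * (\<integral>x. \<bar>h x\<bar> powr s \<partial>M) + (\<integral>x. T x * \<bar>h x\<bar> \<partial>M))"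
      using 2 3 4 by (simp add: field_simps)
    also have "\<dots> = (\<integral>x. - (e * \<bar>h x\<bar> + A * \<bar>h x\<bar> powr s + T x * \<bar>h x\<bar>) \<partial>M)"
      using i1 iT ih by simp
    also have "\<dots> \<le> (\<integral>x. \<bar>v x + h x\<bar> powr p - \<bar>v x\<bar> powr p - \<zeta> x * h x \<partial>M)"
    proof (rule integral_mono)
      show "- (e * \<bar>h x\<bar> + A * \<bar>h x\<bar> powr s + T x * \<bar>h x\<bar>)
          \<le> \<bar>v x + h x\<bar> powr p - \<bar>v x\<bar> powr p - \<zeta> x * h x" for x
        unfolding A_def T_def
        by (rule abs_powr_add_lower_bound[OF p sr(1) c \<zeta>_eq \<tau>]) (use e in auto)
    qed (use i1 iT ih iq in auto)
    also have "\<dots> = q_functional M p (\<lambda>x. v x + h x) - q_functional M p v - (\<integral>x. \<zeta> x * h x \<partial>M)"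
      using iq by (simp add: q_functional_def)
    finally show "q_functional M p (\<lambda>x. v x + h x) - q_functional M p v - (\<integral>x. \<zeta> x * h x \<partial>M) \<ge> - \<epsilon> * Lp_norm M s h"
      by (simp add: L_def)
  qed
qed

text \<open>A step of length at most \<open>\<delta> / 2\<close> keeps the modulus at least
  \<open>\<delta> / 2\<close> on the tested set, so \<open>powr_lipschitz\<close> limits the growth
  of the functional and hence the subgradient. The bound depends on \<open>p\<close> and
  \<open>\<delta>\<close> only, so it can serve a whole sequence of functions
  \<open>v\<close>.\<close>

lemma (in finite_measure) frechet_subdiff_q_functional_bound:
  assumes p: "0 < p" "p < 1" and sr: "1 < s" "1 < r" "1 / s + 1 / r = 1"
    and v: "v \<in> Lp M s" and \<zeta>: "\<zeta> \<in> frechet_subdiff M s r (q_functional M p) v" and \<delta>: "0 < \<delta>"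
  shows "AE x in M. \<delta> \<le> \<bar>v x\<bar> \<longrightarrow> \<bar>\<zeta> x\<bar> \<le> p * (\<delta> / 2) powr (p - 1)"
proof -
  define C where "C = p * (\<delta> / 2) powr (p - 1)"
  have \<zeta>r: "\<zeta> \<in> Lp M r" using \<zeta> by (simp add: frechet_subdiff_iff)
  note [measurable] = LpD(1)[OF \<zeta>r] LpD(1)[OF v]
  define B where "B = {x \<in> space M. \<delta> \<le> \<bar>v x\<bar> \<and> C < \<bar>\<zeta> x\<bar>}"
  have B[measurable]: "B \<in> sets M" unfolding B_def by measurable
  \<comment> \<open>testing with \<open>h = t g\<close>, \<open>t \<down> 0\<close>, gives \<open>\<integral>\<^sub>B \<bar>\<zeta>\<bar> \<le> C |B|\<close>, so \<open>B\<close> is a null set\<close>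
  define g where "g x = indicat_real B x * sgn (\<zeta> x)" for x
  have g[measurable]: "g \<in> borel_measurable M" unfolding g_def by measurable
  have gle: "\<bar>g x\<bar> \<le> 1" for x by (auto simp: g_def indicator_def sgn_if)
  have gLp: "g \<in> Lp M s" using gle sr by (intro Lp_bounded[where C = 1]) auto
  have absg: "\<bar>g x\<bar> = indicat_real B x" for x
  proof -
    have "0 \<le> C" using p by (simp add: C_def)
    then show ?thesis by (auto simp: g_def indicator_def B_def abs_sgn_eq)
  qed
  have i\<zeta>: "integrable M (\<lambda>x. \<zeta> x * g x)" by (rule Holder_inequality(1)[OF sr \<zeta>r gLp])
  have \<zeta>g: "\<zeta> x * g x = indicat_real B x * \<bar>\<zeta> x\<bar>" for x
    by (auto simp: g_def indicator_def abs_sgn mult.commute)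
  have iB: "integrable M (indicat_real B)"
    by (intro integrable_real_indicator) (auto simp: emeasure_eq_measure)
  have indicator_powr: "indicat_real B x powr s = indicat_real B x" for x
    by (simp add: indicator_def)
  define G where "G = Lp_norm M s g"
  have key: "(\<integral>x. \<zeta> x * g x \<partial>M) - C * (\<integral>x. indicat_real B x \<partial>M) \<le> \<epsilon> * G" if \<epsilon>: "0 < \<epsilon>" for \<epsilon>
  \<comment> \<open>Directions of norm zero are excluded from the subdifferential; if
    \<open>g\<close> is one, \<open>B\<close> is null and both integrals vanish.\<close>
  proof (cases "G = 0")
    case True
    then have "(\<integral>x. indicat_real B x \<partial>M) = 0"
      by (simp add: G_def Lp_norm_def absg indicator_powr)
    then have "AE x in M. indicat_real B x = 0"
      using iB by (subst (asm) integral_nonneg_eq_0_iff_AE) auto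
    then have "AE x in M. \<zeta> x * g x = 0" unfolding \<zeta>g by eventually_elim auto
    then have "(\<integral>x. \<zeta> x * g x \<partial>M) = (\<integral>x. 0 \<partial>M)" by (intro integral_cong_AE) auto
    then show ?thesis using True \<open>(\<integral>x. indicat_real B x \<partial>M) = 0\<close> by simp
  next
    case False
    then have G: "0 < G" using Lp_norm_nonneg[of M s g] by (simp add: G_def)
    obtain \<rho> where \<rho>: "0 < \<rho>" "\<And>h. h \<in> Lp M s \<Longrightarrow> 0 < Lp_norm M s h \<Longrightarrow> Lp_norm M s h < \<rho> \<Longrightarrow>
      q_functional M p (\<lambda>x. v x + h x) - q_functional M p v - (\<integral>x. \<zeta> x * h x \<partial>M) \<ge> - \<epsilon> * Lp_norm M s h"
      using \<zeta> \<epsilon> unfolding frechet_subdiff_iff by blast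
    \<comment> \<open>The first bound keeps \<open>|v + t * g|\<close> at least
      \<open>\<delta> / 2\<close> on \<open>B\<close>; the factor \<open>2\<close> in the second
      makes \<open>t * G < \<rho>\<close> strict.\<close>
    define t where "t = min (\<delta> / 2) (\<rho> / (2 * G))"
    have t: "0 < t" "t \<le> \<delta> / 2" "t * G < \<rho>"
    proof -
      have "t * G \<le> \<rho> / (2 * G) * G" using G by (intro mult_right_mono) (auto simp: t_def)
      then show "t * G < \<rho>" using G \<rho> by simp
    qed (use \<delta> \<rho> G in \<open>auto simp: t_def\<close>)
    have norm: "Lp_norm M s (\<lambda>x. t * g x) = t * G"
      using t sr by (simp add: G_def Lp_norm_def abs_mult powr_mult powr_powr)
    have tg: "(\<lambda>x. t * g x) \<in> Lp M s" by (rule Lp_scale[OF gLp])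
    have "- \<epsilon> * (t * G) \<le> q_functional M p (\<lambda>x. v x + t * g x) - q_functional M p v - (\<integral>x. \<zeta> x * (t * g x) \<partial>M)"
      using \<rho>(2)[OF tg] t G unfolding norm by simp
    also have "(\<integral>x. \<zeta> x * (t * g x) \<partial>M) = t * (\<integral>x. \<zeta> x * g x \<partial>M)"
      by (simp add: mult.left_commute)
    also have "q_functional M p (\<lambda>x. v x + t * g x) - q_functional M p v \<le> C * t * (\<integral>x. indicat_real B x \<partial>M)"
    proof -
      have vh: "(\<lambda>x. v x + t * g x) \<in> Lp M p" "v \<in> Lp M p"
        using p sr v tg by (auto intro!: Lp_mono[of _ s] Lp_add)
      note iq = LpD(2)[OF vh(1)] LpD(2)[OF vh(2)]
      have "q_functional M p (\<lambda>x. v x + t * g x) - q_functional M p v =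
          (\<integral>x. \<bar>v x + t * g x\<bar> powr p - \<bar>v x\<bar> powr p \<partial>M)"
        using iq by (simp add: q_functional_def)
      also have "\<dots> \<le> (\<integral>x. C * t * indicat_real B x \<partial>M)"
      proof (rule integral_mono)
        show "\<bar>v x + t * g x\<bar> powr p - \<bar>v x\<bar> powr p \<le> C * t * indicat_real B x" for x
        proof (cases "x \<in> B")
          case True
          have tgx: "\<bar>t * g x\<bar> = t" using t True absg[of x] by (simp add: abs_mult)
          have vx: "\<delta> \<le> \<bar>v x\<bar>" using True by (simp add: B_def)
          have "\<bar>\<bar>v x + t * g x\<bar> powr p - \<bar>v x\<bar> powr p\<bar> \<le>
              \<bar>p\<bar> * (\<delta> / 2) powr (p - 1) * \<bar>\<bar>v x + t * g x\<bar> - \<bar>v x\<bar>\<bar>"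
          proof (rule powr_lipschitz)
            show "\<delta> / 2 \<le> \<bar>v x + t * g x\<bar>" using vx tgx t by linarith
          qed (use p \<delta> vx in auto)
          also have "\<dots> \<le> \<bar>p\<bar> * (\<delta> / 2) powr (p - 1) * t"
            using tgx by (intro mult_left_mono) auto
          finally show ?thesis using True p by (simp add: C_def)
        qed (simp add: g_def)
      qed (use iB iq in auto)
      finally show ?thesis by simp
    qed
    finally have "t * ((\<integral>x. \<zeta> x * g x \<partial>M) - C * (\<integral>x. indicat_real B x \<partial>M)) \<le> t * (\<epsilon> * G)"
      by (simp add: algebra_simps)
    then show ?thesis using t by (simp add: mult_le_cancel_left_pos)
  qed
  \<comment> \<open>Dividing by \<open>G + 1\<close> absorbs the factor \<open>G\<close> even when
    \<open>G = 0\<close>, and \<open>\<epsilon>\<close> may then tend to zero.\<close>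
  have "(\<integral>x. \<zeta> x * g x \<partial>M) - C * (\<integral>x. indicat_real B x \<partial>M) \<le> 0 + \<epsilon>" if "0 < \<epsilon>" for \<epsilon>
  proof -
    have "0 \<le> G" by (simp add: G_def Lp_norm_nonneg)
    moreover have "\<epsilon> / (G + 1) * G \<le> \<epsilon>" using that \<open>0 \<le> G\<close> by (simp add: field_simps)
    ultimately show ?thesis using key[of "\<epsilon> / (G + 1)"] that by (simp add: add_nonneg_pos)
  qed
  then have "(\<integral>x. \<zeta> x * g x \<partial>M) - C * (\<integral>x. indicat_real B x \<partial>M) \<le> 0" by (rule field_le_epsilon)
  moreover have "(\<integral>x. indicat_real B x * (\<bar>\<zeta> x\<bar> - C) \<partial>M) =
      (\<integral>x. \<zeta> x * g x - C * indicat_real B x \<partial>M)"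
    by (intro Bochner_Integration.integral_cong refl) (simp add: \<zeta>g algebra_simps)
  moreover have "\<dots> = (\<integral>x. \<zeta> x * g x \<partial>M) - C * (\<integral>x. indicat_real B x \<partial>M)"
    using i\<zeta> iB by (subst Bochner_Integration.integral_diff) auto
  ultimately have le0: "(\<integral>x. indicat_real B x * (\<bar>\<zeta> x\<bar> - C) \<partial>M) \<le> 0" by simp
  \<comment> \<open>On \<open>B\<close> the difference \<open>|\<zeta> x| - C\<close> is strictly
    positive, so its integral can vanish only if \<open>B\<close> is null.\<close>
  have nn: "0 \<le> indicat_real B x * (\<bar>\<zeta> x\<bar> - C)" for x by (auto simp: indicator_def B_def)
  have "integrable M (\<lambda>x. \<zeta> x * g x - C * indicat_real B x)" using i\<zeta> iB by auto
  then have "integrable M (\<lambda>x. indicat_real B x * (\<bar>\<zeta> x\<bar> - C))"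
    by (simp add: \<zeta>g algebra_simps)
  moreover have "(\<integral>x. indicat_real B x * (\<bar>\<zeta> x\<bar> - C) \<partial>M) = 0"
    using le0 Bochner_Integration.integral_nonneg[of M "\<lambda>x. indicat_real B x * (\<bar>\<zeta> x\<bar> - C)"] nn by fastforce
  ultimately have "AE x in M. indicat_real B x * (\<bar>\<zeta> x\<bar> - C) = 0"
    using nn by (subst (asm) integral_nonneg_eq_0_iff_AE) auto
  then show ?thesis using AE_space
  proof eventually_elim
    case (elim x)
    then show ?case by (auto simp: indicator_def B_def C_def)
  qed
qed

section \<open>Convergence in norm, weakly and almost everywhere\<close>

lemma LIMSEQ_0_if_abs_le:
  fixes f g :: "nat \<Rightarrow> real"
  assumes "\<And>k. j \<le> k \<Longrightarrow> \<bar>f k\<bar> \<le> g k" "g \<longlonglongrightarrow> 0"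
  shows "f \<longlonglongrightarrow> 0"
proof (rule Lim_null_comparison[OF _ assms(2)])
  show "\<forall>\<^sub>F k in sequentially. norm (f k) \<le> g k"
    using assms(1) by (intro eventually_sequentiallyI[of j]) simp
qed

lemma (in finite_measure) Lp_norm_le_const:
  assumes w: "w \<in> Lp M s" and s: "0 < s" and C: "0 \<le> C" "AE x in M. \<bar>w x\<bar> \<le> C"
  shows "Lp_norm M s w \<le> C * measure M (space M) powr (1 / s)"
proof -
  have "(\<integral>x. \<bar>w x\<bar> powr s \<partial>M) \<le> (\<integral>x. C powr s \<partial>M)"
  proof (rule integral_mono_AE)
    show "AE x in M. \<bar>w x\<bar> powr s \<le> C powr s"
      using C(2) by eventually_elim (use s in \<open>intro powr_mono2, auto\<close>)
  qed (use LpD(2)[OF w] in auto)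
  then have "Lp_norm M s w \<le> (C powr s * measure M (space M)) powr (1 / s)"
    unfolding Lp_norm_def using s by (intro powr_mono2) (auto simp: mult.commute)
  also have "\<dots> = C * measure M (space M) powr (1 / s)"
    using s C by (simp add: powr_mult powr_powr)
  finally show ?thesis .
qed

text \<open>Hoelder's inequality gives both the integrability behind additivity and the bound. These
  are the functionals through which weak convergence is exploited.\<close>

lemma integral_mult_in_Lp_dual:
  assumes "1 < s" "1 < r" "1 / s + 1 / r = 1" "g \<in> Lp M s"
  shows "(\<lambda>w. \<integral>x. w x * g x \<partial>M) \<in> Lp_dual M r"
proof -
  note int = Holder_inequality[OF assms(1-3) _ assms(4)]
  have bound: "\<bar>\<integral>x. w x * g x \<partial>M\<bar> \<le> Lp_norm M s g * Lp_norm M r w" if "w \<in> Lp M r" for w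
    using order_trans[OF integral_abs_bound int(2)[OF that]] by (simp add: mult.commute)
  show ?thesis
    unfolding Lp_dual_def mem_Collect_eq
  proof (intro conjI ballI allI exI)
    show "(\<integral>x. (f x + h x) * g x \<partial>M) = (\<integral>x. f x * g x \<partial>M) + (\<integral>x. h x * g x \<partial>M)"
      if "f \<in> Lp M r" "h \<in> Lp M r" for f h
      unfolding distrib_right by (rule Bochner_Integration.integral_add[OF int(1)[OF that(1)] int(1)[OF that(2)]])
    show "(\<integral>x. (c * f x) * g x \<partial>M) = c * (\<integral>x. f x * g x \<partial>M)" for c f
      by (simp add: mult.assoc)
  qed (rule bound)
qed

text \<open>By linearity \<open>\<phi> (w k) - \<phi> \<eta>\<close> is the value at the difference,
  which the boundedness clause controls by the norm. The difference is written as a sum with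
  \<open>- 1 * \<eta>\<close> to match the clauses of \<open>Lp_dual\<close>.\<close>

lemma Lp_dual_tendsto:
  assumes \<phi>: "\<phi> \<in> Lp_dual M r" and w: "\<And>k. w k \<in> Lp M r" "\<eta> \<in> Lp M r" "0 < r"
    and lim: "Lp_tendsto M r w \<eta>"
  shows "(\<lambda>k. \<phi> (w k)) \<longlonglongrightarrow> \<phi> \<eta>"
proof -
  obtain C where C: "\<And>f. f \<in> Lp M r \<Longrightarrow> \<bar>\<phi> f\<bar> \<le> C * Lp_norm M r f"
    using \<phi> unfolding Lp_dual_def mem_Collect_eq by blast
  have neg: "(\<lambda>x. - 1 * \<eta> x) \<in> Lp M r" by (rule Lp_scale[OF w(2)])
  have add: "\<phi> (\<lambda>x. f x + g x) = \<phi> f + \<phi> g" if "f \<in> Lp M r" "g \<in> Lp M r" for f g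
    using \<phi> that unfolding Lp_dual_def mem_Collect_eq by blast
  have scale: "\<phi> (\<lambda>x. c * f x) = c * \<phi> f" if "f \<in> Lp M r" for c f
    using \<phi> that unfolding Lp_dual_def mem_Collect_eq by blast
  have "\<phi> (\<lambda>x. w k x + - 1 * \<eta> x) = \<phi> (w k) + - 1 * \<phi> \<eta>" for k
    unfolding add[OF w(1) neg] scale[OF w(2)] ..
  then have eq: "\<phi> (\<lambda>x. w k x - \<eta> x) = \<phi> (w k) - \<phi> \<eta>" for k by simp
  have mem: "(\<lambda>x. w k x - \<eta> x) \<in> Lp M r" for k
    using Lp_add[OF w(1) neg w(3)] by simp
  have "(\<lambda>k. C * Lp_norm M r (\<lambda>x. w k x - \<eta> x)) \<longlonglongrightarrow> C * 0"
    using lim unfolding Lp_tendsto_def by (rule tendsto_mult_left)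
  then have "(\<lambda>k. C * Lp_norm M r (\<lambda>x. w k x - \<eta> x)) \<longlonglongrightarrow> 0" by simp
  with C[OF mem] have "(\<lambda>k. \<phi> (w k) - \<phi> \<eta>) \<longlonglongrightarrow> 0"
    unfolding eq by (rule LIMSEQ_0_if_abs_le)
  then show ?thesis by (rule LIM_zero_cancel)
qed

text \<open>Hoelder against the constant \<open>1\<close> turns convergence in \<open>L^s\<close>
  into convergence in \<open>L^1\<close>, for which \<open>tendsto_L1_AE_subseq\<close> yields the
  subsequence.\<close>

lemma (in finite_measure) Lp_tendsto_AE_subseq:
  assumes sr: "1 < s" "1 < r" "1 / s + 1 / r = 1"
    and v: "\<And>k. v k \<in> Lp M s" "u \<in> Lp M s" "Lp_tendsto M s v u"
  shows "\<exists>\<sigma>. strict_mono \<sigma> \<and> (AE x in M. (\<lambda>k. v (\<sigma> k) x) \<longlonglongrightarrow> u x)"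
proof -
  have one: "(\<lambda>_. 1) \<in> Lp M r" using sr by (intro Lp_bounded[where C = 1]) auto
  have d: "(\<lambda>x. v k x - u x) \<in> Lp M s" for k
    using Lp_add[OF v(1) Lp_scale[OF v(2), of "-1"]] sr by simp
  have int: "integrable M (\<lambda>x. v k x - u x)" for k
    using Holder_inequality(1)[OF sr one d] by simp
  have bound: "(\<integral>x. \<bar>v k x - u x\<bar> \<partial>M) \<le> Lp_norm M r (\<lambda>_. 1) * Lp_norm M s (\<lambda>x. v k x - u x)" for k
    using Holder_inequality(2)[OF sr one d] by simp
  have "(\<lambda>k. Lp_norm M r (\<lambda>_. 1) * Lp_norm M s (\<lambda>x. v k x - u x)) \<longlonglongrightarrow> Lp_norm M r (\<lambda>_. 1) * 0"
    using v(3) unfolding Lp_tendsto_def by (rule tendsto_mult_left)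
  then have "(\<lambda>k. Lp_norm M r (\<lambda>_. 1) * Lp_norm M s (\<lambda>x. v k x - u x)) \<longlonglongrightarrow> 0" by simp
  moreover have "\<bar>\<integral>x. norm (v k x - u x) \<partial>M\<bar> \<le>
      Lp_norm M r (\<lambda>_. 1) * Lp_norm M s (\<lambda>x. v k x - u x)" for k
    using bound[of k] by simp
  ultimately have "(\<lambda>k. \<integral>x. norm (v k x - u x) \<partial>M) \<longlonglongrightarrow> 0"
    by (rule LIMSEQ_0_if_abs_le[rotated])
  from tendsto_L1_AE_subseq[OF int this] obtain \<sigma>
    where "strict_mono \<sigma>" and \<sigma>: "AE x in M. (\<lambda>k. v (\<sigma> k) x - u x) \<longlonglongrightarrow> 0"
    by blast
  from \<sigma> have "AE x in M. (\<lambda>k. v (\<sigma> k) x) \<longlonglongrightarrow> u x"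
    by eventually_elim (rule LIM_zero_cancel)
  with \<open>strict_mono \<sigma>\<close> show ?thesis by blast
qed

section \<open>The two inclusions\<close>

text \<open>The tested integrals keep their limit along a subsequence, so one converging almost
  everywhere may be used. Testing with the sign of \<open>\<eta>\<close> on sets where its members
  stay away from \<open>0\<close> shows that \<open>\<eta>\<close> vanishes there; countably many
  such sets cover almost all of \<open>{u \<noteq> 0}\<close>.\<close>

lemma (in finite_measure) singular_subdiff_q_functional_subset:
  assumes p: "0 < p" "p < 1" and sr: "1 < s" "1 < r" "1 / s + 1 / r = 1"
    and u: "u \<in> Lp M s" and \<eta>: "\<eta> \<in> singular_subdiff M s r (q_functional M p) u"
  shows "AE x in M. \<eta> x \<noteq> 0 \<longrightarrow> u x = 0"
proof -
  obtain v t \<zeta> where \<eta>r: "\<eta> \<in> Lp M r" and v: "\<And>k. v k \<in> Lp M s" and t: "\<And>k. t k > (0::real)"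
    and \<zeta>r: "\<And>k. \<zeta> k \<in> Lp M r" and vu: "Lp_tendsto M s v u" and t0: "t \<longlonglongrightarrow> 0"
    and weak: "Lp_weakly_tendsto M r (\<lambda>k x. t k * \<zeta> k x) \<eta>"
    and \<zeta>: "\<And>k. \<zeta> k \<in> frechet_subdiff M s r (q_functional M p) (v k)"
    using \<eta> unfolding singular_subdiff_def by blast
  note [measurable] = LpD(1)[OF \<eta>r] LpD(1)[OF v] LpD(1)[OF \<zeta>r]
  obtain \<sigma> where \<sigma>: "strict_mono \<sigma>" and conv: "AE x in M. (\<lambda>k. v (\<sigma> k) x) \<longlonglongrightarrow> u x"
    using Lp_tendsto_AE_subseq[OF sr v u vu] by blast
  \<comment> \<open>One index sets both the threshold and the starting position, so the sets grow
    with \<open>j\<close>.\<close>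
  define B where "B j = {x \<in> space M. \<forall>k\<ge>j. inverse (real (Suc j)) \<le> \<bar>v (\<sigma> k) x\<bar>}" for j
  have "AE x in M. x \<in> B j \<longrightarrow> \<eta> x = 0" for j
  proof -
    define g where "g x = indicat_real (B j) x * sgn (\<eta> x)" for x
    have B[measurable]: "B j \<in> sets M" unfolding B_def by measurable
    have g[measurable]: "g \<in> borel_measurable M" unfolding g_def by measurable
    have gle: "\<bar>g x\<bar> \<le> 1" for x by (auto simp: g_def indicator_def sgn_if)
    have gLp: "g \<in> Lp M s" using gle sr by (intro Lp_bounded[where C = 1]) auto
    define C where "C = p * (inverse (real (Suc j)) / 2) powr (p - 1)"
    have C: "0 \<le> C" using p by (simp add: C_def)
    have "(\<lambda>k. \<integral>x. (t k * \<zeta> k x) * g x \<partial>M) \<longlonglongrightarrow> (\<integral>x. \<eta> x * g x \<partial>M)"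
      using bspec[OF weak[unfolded Lp_weakly_tendsto_def] integral_mult_in_Lp_dual[OF sr gLp]] by simp
    from LIMSEQ_subseq_LIMSEQ[OF this \<sigma>]
    have lim: "(\<lambda>k. \<integral>x. (t (\<sigma> k) * \<zeta> (\<sigma> k) x) * g x \<partial>M) \<longlonglongrightarrow> (\<integral>x. \<eta> x * g x \<partial>M)"
      by (simp add: o_def)
    \<comment> \<open>The constant \<open>C\<close> does not depend on \<open>k\<close>, so the
      factor \<open>t (\<sigma> k)\<close> forces the integrals to zero.\<close>
    have "\<bar>\<integral>x. (t (\<sigma> k) * \<zeta> (\<sigma> k) x) * g x \<partial>M\<bar> \<le> t (\<sigma> k) * (C * measure M (space M))" if "j \<le> k" for k
    proof -
      have int: "integrable M (\<lambda>x. (t (\<sigma> k) * \<zeta> (\<sigma> k) x) * g x)"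
        by (rule Holder_inequality(1)[OF sr Lp_scale[OF \<zeta>r] gLp])
      have "AE x in M. inverse (real (Suc j)) \<le> \<bar>v (\<sigma> k) x\<bar> \<longrightarrow> \<bar>\<zeta> (\<sigma> k) x\<bar> \<le> C"
        unfolding C_def by (rule frechet_subdiff_q_functional_bound[OF p sr v \<zeta>]) simp
      then have "AE x in M. \<bar>(t (\<sigma> k) * \<zeta> (\<sigma> k) x) * g x\<bar> \<le> t (\<sigma> k) * C"
      proof eventually_elim
        case (elim x)
        show ?case
        proof (cases "x \<in> B j")
          case True
          then have "\<bar>\<zeta> (\<sigma> k) x\<bar> \<le> C" using elim that by (auto simp: B_def)
          then have "t (\<sigma> k) * \<bar>\<zeta> (\<sigma> k) x\<bar> * \<bar>g x\<bar> \<le> t (\<sigma> k) * C * 1"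
            using t[of "\<sigma> k"] gle C by (intro mult_mono) auto
          then show ?thesis using t[of "\<sigma> k"] by (simp add: abs_mult)
        next
          case False
          then have "g x = 0" by (simp add: g_def)
          then show ?thesis using t[of "\<sigma> k"] C by simp
        qed
      qed
      then have "(\<integral>x. \<bar>(t (\<sigma> k) * \<zeta> (\<sigma> k) x) * g x\<bar> \<partial>M) \<le> (\<integral>x. t (\<sigma> k) * C \<partial>M)"
        using int by (intro integral_mono_AE) auto
      then show ?thesis
        using order_trans[OF integral_abs_bound, of M "\<lambda>x. (t (\<sigma> k) * \<zeta> (\<sigma> k) x) * g x"]
        by (simp add: mult.commute mult.left_commute)
    qed
    moreover have "(\<lambda>k. t (\<sigma> k) * (C * measure M (space M))) \<longlonglongrightarrow> 0 * (C * measure M (space M))"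
      using LIMSEQ_subseq_LIMSEQ[OF t0 \<sigma>] by (intro tendsto_mult_right) (simp add: o_def)
    then have "(\<lambda>k. t (\<sigma> k) * (C * measure M (space M))) \<longlonglongrightarrow> 0"
      unfolding mult_zero_left .
    ultimately have "(\<lambda>k. \<integral>x. (t (\<sigma> k) * \<zeta> (\<sigma> k) x) * g x \<partial>M) \<longlonglongrightarrow> 0"
      by (rule LIMSEQ_0_if_abs_le)
    with lim have zero: "(\<integral>x. \<eta> x * g x \<partial>M) = 0" by (rule LIMSEQ_unique)
    have \<eta>g: "\<eta> x * g x = indicat_real (B j) x * \<bar>\<eta> x\<bar>" for x
      by (auto simp: g_def indicator_def abs_sgn mult.commute)
    have "integrable M (\<lambda>x. \<eta> x * g x)" by (rule Holder_inequality(1)[OF sr \<eta>r gLp])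
    then have "AE x in M. indicat_real (B j) x * \<bar>\<eta> x\<bar> = 0"
      using zero unfolding \<eta>g by (subst (asm) integral_nonneg_eq_0_iff_AE) auto
    then show ?thesis by eventually_elim (auto simp: indicator_def)
  qed
  then have "AE x in M. \<forall>j. x \<in> B j \<longrightarrow> \<eta> x = 0"
    unfolding AE_all_countable by blast
  then show ?thesis using conv AE_space
  proof eventually_elim
    case (elim x)
    show ?case
    proof (rule impI, rule ccontr)
      assume "\<eta> x \<noteq> 0" "u x \<noteq> 0"
      \<comment> \<open>For late \<open>j\<close>, half of \<open>|u x|\<close> lies below every
        \<open>|v (\<sigma> k) x|\<close> with \<open>k \<ge> j\<close> and above the threshold of
        \<open>B j\<close>.\<close>
      have "\<forall>\<^sub>F k in sequentially. \<bar>u x\<bar> / 2 < \<bar>v (\<sigma> k) x\<bar>"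
        using tendsto_rabs[OF elim(2)] \<open>u x \<noteq> 0\<close> by (intro order_tendstoD) auto
      moreover have "\<forall>\<^sub>F j in sequentially. inverse (real (Suc j)) < \<bar>u x\<bar> / 2"
        using LIMSEQ_inverse_real_of_nat \<open>u x \<noteq> 0\<close> by (intro order_tendstoD) auto
      ultimately have "\<forall>\<^sub>F j in sequentially. (\<forall>k\<ge>j. \<bar>u x\<bar> / 2 < \<bar>v (\<sigma> k) x\<bar>) \<and>
          inverse (real (Suc j)) < \<bar>u x\<bar> / 2"
        by (intro eventually_conj eventually_all_ge_at_top)
      then obtain j where j: "\<And>k. j \<le> k \<Longrightarrow> \<bar>u x\<bar> / 2 < \<bar>v (\<sigma> k) x\<bar>" "inverse (real (Suc j)) < \<bar>u x\<bar> / 2"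
        using eventually_happens'[OF sequentially_bot] by blast
      have "inverse (real (Suc j)) \<le> \<bar>v (\<sigma> k) x\<bar>" if "j \<le> k" for k
        using j(1)[OF that] j(2) by linarith
      then have "x \<in> B j" using elim(3) unfolding B_def by blast
      then show False using elim(1) \<open>\<eta> x \<noteq> 0\<close> by blast
    qed
  qed
qed

text \<open>Truncation level and multiplier are the same \<open>t k\<close>. On the support the
  derivative is at most \<open>p * t k powr (p - 1)\<close> in modulus; multiplied by
  \<open>t k\<close> this becomes \<open>p * t k powr p\<close>, which tends to zero. So the scaled
  subgradients converge to \<open>\<eta>\<close> even in norm.\<close>

lemma (in finite_measure) singular_subdiff_q_functional_superset:
  assumes p: "0 < p" "p < 1" and sr: "1 < s" "1 < r" "1 / s + 1 / r = 1"
    and u: "u \<in> Lp M s" and \<eta>: "\<eta> \<in> Lp M r" "AE x in M. \<eta> x \<noteq> 0 \<longrightarrow> u x = 0"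
  shows "\<eta> \<in> singular_subdiff M s r (q_functional M p) u"
proof -
  note [measurable] = LpD(1)[OF \<eta>(1)] LpD(1)[OF u]
  define t :: "nat \<Rightarrow> real" where "t k = inverse (real (Suc k))" for k
  have t: "0 < t k" for k by (simp add: t_def)
  have t0: "t \<longlonglongrightarrow> 0" unfolding t_def by (rule LIMSEQ_inverse_real_of_nat)
  have tp0: "(\<lambda>k. t k powr p) \<longlonglongrightarrow> 0"
    using tendsto_powr2[OF t0 tendsto_const, of p] p t by (simp add: less_imp_le)
  define v where "v k x = (if t k \<le> \<bar>u x\<bar> then u x else 0)" for k x
  \<comment> \<open>The derivative part is kept apart because truncation makes it bounded, hence in
    \<open>L^r\<close>; at small nonzero values of \<open>u\<close> it would otherwise be
    large.\<close>
  define b where "b k x = (if t k \<le> \<bar>u x\<bar> then p * \<bar>u x\<bar> powr (p - 1) * sgn (u x) else 0)" for k x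
  define \<zeta> where "\<zeta> k x = b k x + (if t k \<le> \<bar>u x\<bar> then 0 else \<eta> x / t k)" for k x
  have [measurable]: "v k \<in> borel_measurable M" "b k \<in> borel_measurable M" for k
    unfolding v_def[abs_def] b_def[abs_def] by measurable
  have b_le: "\<bar>b k x\<bar> \<le> p * t k powr (p - 1)" for k x
    using p t[of k] by (auto simp: b_def abs_mult abs_sgn_eq intro!: powr_mono2')
  have v: "v k \<in> Lp M s" for k
    using sr by (intro Lp_dominated[OF u]) (auto simp: v_def)
  have \<zeta>: "\<zeta> k \<in> Lp M r" for k
  proof -
    have "b k \<in> Lp M r" using sr b_le by (intro Lp_bounded) auto
    moreover have "(\<lambda>x. if t k \<le> \<bar>u x\<bar> then 0 else \<eta> x / t k) \<in> Lp M r"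
      using sr by (intro Lp_dominated[OF Lp_scale[OF \<eta>(1), of "1 / t k"]]) auto
    ultimately show ?thesis unfolding \<zeta>_def[abs_def] using sr by (intro Lp_add) auto
  qed
  have "Lp_tendsto M s v u"
    unfolding Lp_tendsto_def
  proof (rule Lim_null_comparison)
    \<comment> \<open>The truncation moves \<open>u\<close> by less than \<open>t k\<close>
      everywhere.\<close>
    have "Lp_norm M s (\<lambda>x. v k x - u x) \<le> t k * measure M (space M) powr (1 / s)" for k
    proof (rule Lp_norm_le_const)
      show "(\<lambda>x. v k x - u x) \<in> Lp M s"
        using Lp_add[OF v Lp_scale[OF u, of "-1"]] sr by simp
    qed (use sr t[of k] in \<open>auto simp: v_def\<close>)
    then show "\<forall>\<^sub>F k in sequentially. norm (Lp_norm M s (\<lambda>x. v k x - u x)) \<le> t k * measure M (space M) powr (1 / s)"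
      by (simp add: Lp_norm_nonneg)
    show "(\<lambda>k. t k * measure M (space M) powr (1 / s)) \<longlonglongrightarrow> 0"
      using tendsto_mult_right[OF t0] by simp
  qed
  moreover have "(\<lambda>k. q_functional M p (v k)) \<longlonglongrightarrow> q_functional M p u"
  proof -
    have uv: "u \<in> Lp M p" "v k \<in> Lp M p" for k
      using p sr u v by (auto intro: Lp_mono[of _ s])
    have "\<bar>q_functional M p (v k) - q_functional M p u\<bar> \<le> t k powr p * measure M (space M)" for k
    proof -
      have "q_functional M p (v k) - q_functional M p u = (\<integral>x. \<bar>v k x\<bar> powr p - \<bar>u x\<bar> powr p \<partial>M)"
        using LpD(2)[OF uv(1)] LpD(2)[OF uv(2)] by (simp add: q_functional_def)
      also have "\<bar>\<dots>\<bar> \<le> (\<integral>x. \<bar>\<bar>v k x\<bar> powr p - \<bar>u x\<bar> powr p\<bar> \<partial>M)"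
        by (rule integral_abs_bound)
      also have "\<dots> \<le> (\<integral>x. t k powr p \<partial>M)"
      proof (rule integral_mono)
        show "\<bar>\<bar>v k x\<bar> powr p - \<bar>u x\<bar> powr p\<bar> \<le> t k powr p" for x
          using p t[of k] by (auto simp: v_def intro!: powr_mono2)
        show "integrable M (\<lambda>x. \<bar>\<bar>v k x\<bar> powr p - \<bar>u x\<bar> powr p\<bar>)"
          by (intro integrable_abs Bochner_Integration.integrable_diff LpD(2) uv)
      qed simp
      finally show ?thesis by (simp add: mult.commute)
    qed
    moreover have "(\<lambda>k. t k powr p * measure M (space M)) \<longlonglongrightarrow> 0"
      using tendsto_mult_right[OF tp0] by simp
    ultimately have "(\<lambda>k. q_functional M p (v k) - q_functional M p u) \<longlonglongrightarrow> 0"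
      by (rule LIMSEQ_0_if_abs_le)
    then show ?thesis by (rule LIM_zero_cancel)
  qed
  moreover have "Lp_weakly_tendsto M r (\<lambda>k x. t k * \<zeta> k x) \<eta>"
  proof -
    have lim: "Lp_tendsto M r (\<lambda>k x. t k * \<zeta> k x) \<eta>"
      unfolding Lp_tendsto_def
    proof (rule Lim_null_comparison)
      have "Lp_norm M r (\<lambda>x. t k * \<zeta> k x - \<eta> x) \<le> p * t k powr p * measure M (space M) powr (1 / r)" for k
      proof (rule Lp_norm_le_const)
        show "(\<lambda>x. t k * \<zeta> k x - \<eta> x) \<in> Lp M r"
          using Lp_add[OF Lp_scale[OF \<zeta>] Lp_scale[OF \<eta>(1), of "-1"]] sr by simp
        show "AE x in M. \<bar>t k * \<zeta> k x - \<eta> x\<bar> \<le> p * t k powr p"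
          using \<eta>(2)
        proof eventually_elim
          case (elim x)
          show ?case
          proof (cases "t k \<le> \<bar>u x\<bar>")
            case True
            \<comment> \<open>Where \<open>u\<close> survives the truncation it is nonzero, so
              \<open>\<eta>\<close> vanishes and only the derivative part remains. Below the level
              the scaled value is exactly \<open>\<eta> x\<close>.\<close>
            then have "\<eta> x = 0" using elim t[of k] by auto
            then have "\<bar>t k * \<zeta> k x - \<eta> x\<bar> = t k * \<bar>b k x\<bar>"
              using True t[of k] by (simp add: \<zeta>_def abs_mult)
            also have "\<dots> \<le> t k * (p * t k powr (p - 1))"
              using b_le t[of k] by (intro mult_left_mono) auto
            also have "\<dots> = p * t k powr p"
              using powr_mult_base[of "t k" "p - 1"] t[of k] by simp
            finally show ?thesis .
          next
            case False
            then show ?thesis using t[of k] p by (simp add: \<zeta>_def b_def)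
          qed
        qed
      qed (use sr p in auto)
      then show "\<forall>\<^sub>F k in sequentially. norm (Lp_norm M r (\<lambda>x. t k * \<zeta> k x - \<eta> x)) \<le> p * t k powr p * measure M (space M) powr (1 / r)"
        by (simp add: Lp_norm_nonneg)
      show "(\<lambda>k. p * t k powr p * measure M (space M) powr (1 / r)) \<longlonglongrightarrow> 0"
        using tendsto_mult_right[OF tendsto_mult_left[OF tp0]] by simp
    qed
    have r: "0 < r" using sr by simp
    show ?thesis
      unfolding Lp_weakly_tendsto_def
      by (rule ballI) (rule Lp_dual_tendsto[OF _ Lp_scale[OF \<zeta>] \<eta>(1) r lim])
  qed
  \<comment> \<open>On the support of \<open>v k\<close> the modulus is at least \<open>t k\<close>,
    which serves as the constant \<open>c\<close>.\<close>
  moreover have "\<zeta> k \<in> frechet_subdiff M s r (q_functional M p) (v k)" for k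
    by (rule frechet_subdiff_q_functionalI[OF p sr v \<zeta> t[of k]])
      (auto simp: v_def \<zeta>_def b_def split: if_splits)
  ultimately show ?thesis
    unfolding singular_subdiff_def using \<eta> v \<zeta> t t0 by blast
qed

theorem theorem4p7:
  fixes \<Omega> :: "(real ^ 'd) set" and p s r :: real and u :: "real ^ 'd \<Rightarrow> real"
  assumes "\<Omega> \<in> sets lebesgue" and "0 < emeasure lebesgue \<Omega>" and "emeasure lebesgue \<Omega> < \<infinity>"
    and "0 < p" and "p < 1"
    and "1 < s" and "1 < r" and "1 / s + 1 / r = 1"
    and "u \<in> Lp (lebesgue_on \<Omega>) s"
  shows "singular_subdiff (lebesgue_on \<Omega>) s r (q_functional (lebesgue_on \<Omega>) p) u =
    {\<eta> \<in> Lp (lebesgue_on \<Omega>) r. AE x in lebesgue_on \<Omega>. \<eta> x \<noteq> 0 \<longrightarrow> u x = 0}"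
proof -
  \<comment> \<open>Both inclusions hold over any finite measure, and \<open>\<Omega>\<close> has
    finite Lebesgue measure.\<close>
  interpret finite_measure "lebesgue_on \<Omega>"
    by (rule finite_measure_lebesgue_on[OF fmeasurableI[OF assms(1,3)]])
  have "\<eta> \<in> Lp (lebesgue_on \<Omega>) r"
    if "\<eta> \<in> singular_subdiff (lebesgue_on \<Omega>) s r (q_functional (lebesgue_on \<Omega>) p) u" for \<eta>
    using that by (simp add: singular_subdiff_def)
  then show ?thesis
    using singular_subdiff_q_functional_subset[OF assms(4-9)]
      singular_subdiff_q_functional_superset[OF assms(4-9)] by blast
qed

end
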